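(* Let $J\subset\mathcal P=k[X_0,\dots,X_n]$ be a strongly stable monomial ideal with monomial basis $B_J$ and let $I\subset\mathcal P$ be a homogeneous ideal that contains a $J$-set $G=\{f_\alpha=X^\alpha-\sum c_{\alpha\gamma}X^\gamma\mid X^\alpha\in B_J\}$. Then: i) every polynomial $h\in\mathcal P$ has a normal form modulo $I$ as a sum of monomials in $\mathcal N(J)$ (i.e. there is a $k$-linear combination $h_0$ of monomials in $\mathcal N(J)$ with $h-h_0\in I$) that can be obtained from $h$ through a $G^*$-reduction; ii) $\mathcal N(J)$ generates $\mathcal P/I$ as a $k$-vector space, so that $\dim_k I_m\ge\dim_k J_m$ for every $m\ge0$.
   Context: $k$ is an algebraically closed field of any characteristic, $\mathcal P=k[X_0,\dots,X_n]$ with the variables ordered $X_0<X_1<\dots<X_n$; $X^\alpha=X_0^{\alpha_0}\cdots X_n^{\alpha_n}$. For a monomial ideal $J$, $B_J$ is its set of minimal monomial generators, $\mathcal N(J)$ is the set of monomials not in $J$; $I_m$, $J_m$ denote degree $m$ parts. Strongly stable: an up elementary move replaces a monomial $X^\delta X_i$ by $X^\delta X_j$ with $X_i<X_j$; write $X^\alpha\prec_B X^\beta$ if $X^\beta$ is obtained from $X^\alpha$ by a sequence of up elementary moves. $J$ is strongly stable if it contains every monomial $X^\alpha$ with $X^\alpha\succ_B X^\beta$ for some monomial $X^\beta\in J$. $J$-set: a set $G=\{f_\alpha=X^\alpha-\sum c_{\alpha\gamma}X^\gamma \mid X^\alpha\in B_J\}$ of homogeneous polynomials, one for each $X^\alpha\in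 B_J$, with $c_{\alpha\gamma}\in k$ and $X^\gamma\in\mathcal N(J)$ of the same degree as $X^\alpha$. The head of $f_\alpha$ is $X^\alpha$ and its tail is $\sum c_{\alpha\gamma}X^\gamma$. A polynomial is in $J$-normal form if it is a $k$-linear combination of monomials of $\mathcal N(J)$. $G^*$-reduction (defined by recursion on degree): a step of $G^*$-reduction of a polynomial $h$ not in $J$-normal form chooses a monomial $X^\beta\in J$ appearing in $h$ with nonzero coefficient, of degree $m$ say, and replaces it (keeping its coefficient) as follows. If $X^\beta=X^\alpha\in B_J$, it is replaced by the tail of $f_\alpha$. If $X^\beta\notin B_J$, one writes $X^\beta=X_iX^\delta$ with $X_i$ a variable and $X^\delta\in J_{m-1}$, and replaces $X^\beta$ by $X_ig_0$, where $g_0$ is the result of a complete $G^*$-reduction of $X^\delta$. A complete $G^*$-reduction is a finite (possibly empty) sequence of such steps ending in a polynomial in $J$-normal form. *)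

theory Defs
  imports
    "HOL-Library.Poly_Mapping"
    "HOL-Library.Set_Algebras"
    "HOL-Computational_Algebra.Polynomial"
begin

text \<open>
  The variables \<open>X\<^sub>0 < \<dots> < X\<^sub>n\<close> are the elements of a type \<open>'v\<close> of sort
  \<open>{finite, linorder}\<close> with \<open>n + 1\<close> elements; a monomial \<open>X\<^sup>\<alpha>\<close> is represented by its
  exponent \<open>\<alpha>\<close>, and monomials are multiplied by adding exponents.  The library's linear order on
  \<open>'v \<Rightarrow>\<^sub>0 nat\<close> plays no role here.
\<close>

type_synonym 'v mon = "'v \<Rightarrow>\<^sub>0 nat"
type_synonym ('v, 'k) mpoly = "'v mon \<Rightarrow>\<^sub>0 'k"

abbreviation var :: "'v \<Rightarrow> 'v mon" where
  "var i \<equiv> Poly_Mapping.single i 1"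

abbreviation X :: "'v mon \<Rightarrow> ('v, 'k::zero_neq_one) mpoly" where
  "X \<alpha> \<equiv> Poly_Mapping.single \<alpha> 1"

definition mdeg :: "'v::finite mon \<Rightarrow> nat" where
  "mdeg \<alpha> = (\<Sum>i\<in>UNIV. Poly_Mapping.lookup \<alpha> i)"

definition pscale :: "'k::comm_ring_1 \<Rightarrow> ('v, 'k) mpoly \<Rightarrow> ('v, 'k) mpoly" where
  "pscale c p = Poly_Mapping.single 0 c * p"

global_interpretation poly_vs: vector_space "pscale :: 'k::field \<Rightarrow> ('v, 'k) mpoly \<Rightarrow> _"
  by unfold_locales
    (simp_all add: pscale_def algebra_simps single_add mult_single flip: mult.assoc)

text \<open>Ideals of a commutative ring are its submodules.\<close>

global_interpretation ideal: module "(*) :: 'a::comm_ring_1 \<Rightarrow> 'a \<Rightarrow> 'a"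
  by unfold_locales (simp_all add: algebra_simps)

definition monomial_ideal :: "('v, 'k::comm_ring_1) mpoly set \<Rightarrow> bool" where
  "monomial_ideal J \<longleftrightarrow> (\<exists>S. J = ideal.span (X ` S))"

definition hcomp :: "nat \<Rightarrow> ('v::finite, 'k::comm_ring_1) mpoly \<Rightarrow> ('v, 'k) mpoly" where
  "hcomp m p = (\<Sum>\<alpha> | \<alpha> \<in> Poly_Mapping.keys p \<and> mdeg \<alpha> = m.
     Poly_Mapping.single \<alpha> (Poly_Mapping.lookup p \<alpha>))"

definition homogeneous_ideal :: "('v::finite, 'k::comm_ring_1) mpoly set \<Rightarrow> bool" where
  "homogeneous_ideal I \<longleftrightarrow> ideal.subspace I \<and> (\<forall>p\<in>I. \<forall>m. hcomp m p \<in> I)"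

definition degree_part :: "('v::finite, 'k::zero) mpoly set \<Rightarrow> nat \<Rightarrow> ('v, 'k) mpoly set" where
  "degree_part I m = {p \<in> I. \<forall>\<alpha>\<in>Poly_Mapping.keys p. mdeg \<alpha> = m}"

definition monomials_in :: "('v, 'k::zero_neq_one) mpoly set \<Rightarrow> 'v mon set" where
  "monomials_in J = {\<alpha>. X \<alpha> \<in> J}"

definition monomials_out :: "('v, 'k::zero_neq_one) mpoly set \<Rightarrow> 'v mon set" (\<open>\<N>\<close>) where
  "\<N> J = {\<alpha>. X \<alpha> \<notin> J}"

definition min_gens :: "('v, 'k::zero_neq_one) mpoly set \<Rightarrow> 'v mon set" (\<open>\<B>\<close>) where
  "\<B> J = {\<alpha> \<in> monomials_in J. \<forall>\<beta>\<in>monomials_in J. (\<exists>\<delta>. \<alpha> = \<beta> + \<delta>) \<longrightarrow> \<beta> = \<alpha>}"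

definition up_move :: "'v::linorder mon \<Rightarrow> 'v mon \<Rightarrow> bool" where
  "up_move \<alpha> \<beta> \<longleftrightarrow> (\<exists>\<delta> i j. i < j \<and> \<alpha> = \<delta> + var i \<and> \<beta> = \<delta> + var j)"

abbreviation borel_less :: "'v::linorder mon \<Rightarrow> 'v mon \<Rightarrow> bool" (infix \<open>\<prec>\<^sub>B\<close> 50) where
  "\<alpha> \<prec>\<^sub>B \<beta> \<equiv> up_move\<^sup>+\<^sup>+ \<alpha> \<beta>"

definition strongly_stable :: "('v::linorder, 'k::zero_neq_one) mpoly set \<Rightarrow> bool" where
  "strongly_stable J \<longleftrightarrow> (\<forall>\<alpha> \<beta>. \<beta> \<in> monomials_in J \<and> \<beta> \<prec>\<^sub>B \<alpha> \<longrightarrow> \<alpha> \<in> monomials_in J)"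

definition normal_form :: "('v, 'k::zero_neq_one) mpoly set \<Rightarrow> ('v, 'k) mpoly \<Rightarrow> bool" where
  "normal_form J h \<longleftrightarrow> Poly_Mapping.keys h \<subseteq> \<N> J"

text \<open>
  A \<open>J\<close>-set is given as the family \<open>\<alpha> \<mapsto> f\<^sub>\<alpha>\<close>; only its values at \<open>\<alpha> \<in> \<B> J\<close> matter.
\<close>

definition tail :: "('v mon \<Rightarrow> ('v, 'k::comm_ring_1) mpoly) \<Rightarrow> 'v mon \<Rightarrow> ('v, 'k) mpoly" where
  "tail f \<alpha> = X \<alpha> - f \<alpha>"

definition J_set ::
  "('v::finite, 'k::comm_ring_1) mpoly set \<Rightarrow> ('v mon \<Rightarrow> ('v, 'k) mpoly) \<Rightarrow> bool" where
  "J_set J f \<longleftrightarrow>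
     (\<forall>\<alpha>\<in>\<B> J. Poly_Mapping.keys (tail f \<alpha>) \<subseteq> {\<gamma> \<in> \<N> J. mdeg \<gamma> = mdeg \<alpha>})"

definition replace ::
  "('v, 'k::comm_ring_1) mpoly \<Rightarrow> 'v mon \<Rightarrow> ('v, 'k) mpoly \<Rightarrow> ('v, 'k) mpoly" where
  "replace h \<beta> g = h - pscale (Poly_Mapping.lookup h \<beta>) (X \<beta>) + pscale (Poly_Mapping.lookup h \<beta>) g"

text \<open>
  The recursion on the degree becomes an inductive definition: a step at \<open>X\<^sup>\<beta> = X\<^sub>i X\<^sup>\<delta>\<close> refers to
  a complete reduction of \<open>X\<^sup>\<delta>\<close>, all of whose steps take place in degree \<open>mdeg \<beta> - 1\<close> when
  \<open>f\<close> is a \<open>J\<close>-set.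
\<close>

inductive gstar_step ::
  "('v, 'k::comm_ring_1) mpoly set \<Rightarrow> ('v mon \<Rightarrow> ('v, 'k) mpoly) \<Rightarrow>
   ('v, 'k) mpoly \<Rightarrow> ('v, 'k) mpoly \<Rightarrow> bool"
  for J f where
  generator: "gstar_step J f h (replace h \<beta> (tail f \<beta>))"
    if "\<beta> \<in> Poly_Mapping.keys h" "\<beta> \<in> \<B> J"
| multiple: "gstar_step J f h (replace h \<beta> (X (var i) * g0))"
    if "\<beta> \<in> Poly_Mapping.keys h" "\<beta> \<in> monomials_in J" "\<beta> \<notin> \<B> J"
      "\<beta> = var i + \<delta>" "\<delta> \<in> monomials_in J"
      "(gstar_step J f)\<^sup>*\<^sup>* (X \<delta>) g0" "normal_form J g0"

definition complete_gstar_reduction ::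
  "('v, 'k::comm_ring_1) mpoly set \<Rightarrow> ('v mon \<Rightarrow> ('v, 'k) mpoly) \<Rightarrow>
   ('v, 'k) mpoly \<Rightarrow> ('v, 'k) mpoly \<Rightarrow> bool" where
  "complete_gstar_reduction J f h h0 \<longleftrightarrow> (gstar_step J f)\<^sup>*\<^sup>* h h0 \<and> normal_form J h0"

text \<open>
  The quotient space is the set of cosets \<open>p +o I\<close>, with zero \<open>I\<close>, elementwise addition of cosets,
  and scalar multiplication \<open>coset_scale\<close>.  Adding \<open>I\<close> there matters only for the scalar \<open>0\<close>.
\<close>

definition quotient_space :: "('v, 'k::comm_ring_1) mpoly set \<Rightarrow> ('v, 'k) mpoly set set" where
  "quotient_space I = (\<lambda>p. p +o I) ` UNIV"

definition coset_scale ::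
  "('v, 'k::comm_ring_1) mpoly set \<Rightarrow> 'k \<Rightarrow> ('v, 'k) mpoly set \<Rightarrow> ('v, 'k) mpoly set" where
  "coset_scale I c A = pscale c ` A + I"

lemma coset_zero: "(0 :: ('v, 'k::comm_ring_1) mpoly) +o I = I"
  by (simp add: elt_set_plus_def)

lemma coset_add:
  assumes "ideal.subspace I"
  shows "(p +o I) + (q +o I) = (p + q) +o I"
proof -
  have "I + I = I"
  proof
    show "I + I \<subseteq> I"
      using ideal.subspace_add[OF assms] by (auto elim!: set_plus_elim)
    show "I \<subseteq> I + I"
      using set_zero_plus2[OF ideal.subspace_0[OF assms]] .
  qed
  then show ?thesis
    by (metis set_plus_rearrange)
qed

lemma coset_scale_coset:
  assumes "ideal.subspace I"
  shows "coset_scale I c (p +o I) = pscale c p +o I"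
proof (intro equalityI subsetI)
  fix x assume "x \<in> coset_scale I c (p +o I)"
  then obtain a b where ab: "a \<in> I" "b \<in> I" "x = pscale c (p + a) + b"
    by (auto simp: coset_scale_def elt_set_plus_def elim!: set_plus_elim)
  then have "pscale c a + b \<in> I"
    using ideal.subspace_add[OF assms] ideal.subspace_scale[OF assms] by (simp add: pscale_def)
  moreover have "x = pscale c p + (pscale c a + b)"
    using ab by (simp add: pscale_def algebra_simps)
  ultimately show "x \<in> pscale c p +o I"
    by (auto simp: elt_set_plus_def)
next
  fix x assume "x \<in> pscale c p +o I"
  moreover have "p \<in> p +o I"
    using ideal.subspace_0[OF assms] by (force simp: elt_set_plus_def)
  ultimately show "x \<in> coset_scale I c (p +o I)"
    by (auto simp: coset_scale_def elt_set_plus_def intro!: set_plus_intro)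
qed

inductive_set quotient_span ::
  "('v, 'k::comm_ring_1) mpoly set \<Rightarrow> ('v, 'k) mpoly set set \<Rightarrow> ('v, 'k) mpoly set set"
  for I S where
  zero: "I \<in> quotient_span I S"
| base: "A \<in> S \<Longrightarrow> A \<in> quotient_span I S"
| add: "A \<in> quotient_span I S \<Longrightarrow> B \<in> quotient_span I S \<Longrightarrow> A + B \<in> quotient_span I S"
| scale: "A \<in> quotient_span I S \<Longrightarrow> coset_scale I c A \<in> quotient_span I S"

end

theory Submission
  imports Defs
begin

text \<open>
  A monomial \<open>X\<^sup>\<beta> \<in> J\<close> that is not a generator is divided by its smallest variable \<open>X\<^sub>i\<close>; by strong
  stability the quotient still lies in \<open>J\<close>.  If \<open>g\<^sub>0\<close> is the normal form of the quotient, every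
  monomial of \<open>X\<^sub>i g\<^sub>0\<close> lying in \<open>J\<close> is a generator or is divisible by a variable smaller than
  \<open>X\<^sub>i\<close>, since dividing it by \<open>X\<^sub>i\<close> leaves \<open>J\<close>.  As there are finitely many variables, reduction that
  always divides by the smallest variable terminates.  For the dimensions, the projection of \<open>I\<^sub>m\<close>
  onto the monomials of \<open>J\<close> covers \<open>J\<^sub>m\<close>, because \<open>q \<in> J\<^sub>m\<close> is the image of \<open>q\<close> minus its normal form.
\<close>

section \<open>Monomials\<close>

lemma mdeg_add: "mdeg (\<alpha> + \<beta>) = mdeg \<alpha> + mdeg \<beta>"
  by (simp add: mdeg_def lookup_add sum.distrib)

lemma mdeg_var [simp]: "mdeg (Poly_Mapping.single i (Suc 0)) = 1"
  by (simp add: mdeg_def lookup_single when_def)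

text \<open>Each exponent is bounded by the total degree, and there are finitely many variables.
  This makes every \<open>degree_part\<close> finite-dimensional.\<close>

lemma finite_mdeg_eq: "finite {\<alpha> :: 'v::finite mon. mdeg \<alpha> = m}"
proof (rule finite_imageD)
  have "finite {g :: 'v \<Rightarrow> nat. \<forall>i. g i \<in> {..m}}"
    using finite_set_of_finite_funs[of "UNIV :: 'v set" "{..m}" 0] by simp
  moreover have "Poly_Mapping.lookup ` {\<alpha> :: 'v mon. mdeg \<alpha> = m} \<subseteq> {g. \<forall>i. g i \<in> {..m}}"
  proof clarsimp
    fix \<alpha> :: "'v mon" and i
    assume "m = mdeg \<alpha>"
    show "Poly_Mapping.lookup \<alpha> i \<le> mdeg \<alpha>"
      unfolding mdeg_def by (rule member_le_sum) auto
  qed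
  ultimately show "finite (Poly_Mapping.lookup ` {\<alpha> :: 'v mon. mdeg \<alpha> = m})"
    by (rule rev_finite_subset)
  show "inj_on Poly_Mapping.lookup {\<alpha> :: 'v mon. mdeg \<alpha> = m}"
    by (simp add: inj_on_def poly_mapping.lookup_inject)
qed

lemma mon_eq_var_add:
  fixes \<alpha> :: "'v mon"
  assumes "i \<in> Poly_Mapping.keys \<alpha>"
  obtains \<delta> where "\<alpha> = var i + \<delta>"
proof
  show "\<alpha> = var i + (\<alpha> - var i)"
    using assms by (intro poly_mapping_eqI)
      (auto simp: lookup_add lookup_minus lookup_single when_def in_keys_iff)
qed

lemma keys_var_mult:
  "Poly_Mapping.keys (X (var i) * (g :: ('v, 'k::comm_ring_1) mpoly))
     \<subseteq> (+) (var i) ` Poly_Mapping.keys g"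
proof
  fix \<gamma> assume "\<gamma> \<in> Poly_Mapping.keys (X (var i) * g)"
  then have "\<gamma> \<in> {a + b | a b. a \<in> Poly_Mapping.keys (X (var i) :: ('v, 'k) mpoly) \<and> b \<in> Poly_Mapping.keys g}"
    using keys_mult by blast
  then show "\<gamma> \<in> (+) (var i) ` Poly_Mapping.keys g"
    by auto
qed

section \<open>Monomial ideals and division by a variable\<close>

lemma monomial_ideal_subspace:
  "monomial_ideal J \<Longrightarrow> ideal.subspace J"
  by (auto simp: monomial_ideal_def)

lemma monomials_in_add:
  assumes "monomial_ideal J" "\<alpha> \<in> monomials_in J"
  shows "\<gamma> + \<alpha> \<in> monomials_in J"
proof -
  have "X \<gamma> * X \<alpha> \<in> J"
    using assms monomial_ideal_subspace ideal.subspace_scale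
    by (auto simp: monomials_in_def)
  then show ?thesis
    by (simp add: monomials_in_def mult_single)
qed

text \<open>Multiples of a generating monomial involve only monomials of \<open>J\<close>, and
  adding polynomials creates no new monomials.\<close>

lemma keys_monomial_ideal:
  assumes "monomial_ideal J" "p \<in> J"
  shows "Poly_Mapping.keys p \<subseteq> monomials_in J"
proof -
  obtain S where S: "J = ideal.span (X ` S)"
    using assms(1) by (auto simp: monomial_ideal_def)
  have "p \<in> ideal.span (X ` S)"
    using assms(2) S by simp
  then show ?thesis
  proof (induction rule: ideal.span_induct_alt)
    case base
    then show ?case by simp
  next
    case (step c x y)
    then obtain s where s: "s \<in> S" "x = X s" by auto
    have "s \<in> monomials_in J"
      using s by (auto simp: monomials_in_def S intro: ideal.span_base)
    then have "Poly_Mapping.keys (c * x) \<subseteq> monomials_in J"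
      using keys_mult[of c x] s monomials_in_add[OF assms(1)] by auto
    then show ?case
      using step keys_add[of "c * x" y] by auto
  qed
qed

text \<open>A proper divisor of \<beta> in \<open>J\<close> leaves a nontrivial cofactor. Any
  variable of the cofactor can be split off, and what remains is still a multiple of that
  divisor.\<close>

lemma not_min_gens_divide:
  assumes "monomial_ideal J" "\<beta> \<in> monomials_in J" "\<beta> \<notin> \<B> J"
  obtains l \<delta> where "\<beta> = var l + \<delta>" "\<delta> \<in> monomials_in J"
proof -
  obtain \<gamma> \<epsilon> where g: "\<gamma> \<in> monomials_in J" "\<beta> = \<gamma> + \<epsilon>" "\<gamma> \<noteq> \<beta>"
    using assms by (auto simp: min_gens_def)
  then have "Poly_Mapping.keys \<epsilon> \<noteq> {}"
    by auto
  then obtain l \<delta> where "\<epsilon> = var l + \<delta>"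
    by (metis all_not_in_conv mon_eq_var_add)
  then have "\<beta> = var l + (\<delta> + \<gamma>)"
    using g by (simp add: ac_simps)
  then show ?thesis
    using that monomials_in_add[OF assms(1) g(1)] by blast
qed

text \<open>Some variable \<open>l\<close> can be divided out within \<open>J\<close>. If the
  smallest variable \<open>i\<close> is another one, exchanging \<open>i\<close> for
  \<open>l\<close> in the quotient is an up move, and its result is \<beta> divided by
  \<open>i\<close>.\<close>

lemma strongly_stable_divide_Min:
  assumes J: "monomial_ideal J" "strongly_stable J"
    and \<beta>: "\<beta> \<in> monomials_in J" "\<beta> \<notin> \<B> J"
  obtains \<delta> where "\<beta> = var (Min (Poly_Mapping.keys \<beta>)) + \<delta>" "\<delta> \<in> monomials_in J"
proof -
  define i where "i = Min (Poly_Mapping.keys \<beta>)"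
  obtain l \<delta> where l: "\<beta> = var l + \<delta>" "\<delta> \<in> monomials_in J"
    using not_min_gens_divide J(1) \<beta> by blast
  have l_key: "l \<in> Poly_Mapping.keys \<beta>"
    using l(1) by (simp add: in_keys_iff lookup_add)
  then have i_key: "i \<in> Poly_Mapping.keys \<beta>" and "i \<le> l"
    unfolding i_def by (auto intro!: Min_in)
  show ?thesis
  proof (cases "i = l")
    case True
    then show ?thesis using that l i_def by simp
  next
    case False
    then have "i \<in> Poly_Mapping.keys \<delta>"
      using i_key l(1) by (simp add: in_keys_iff lookup_add lookup_single)
    then obtain \<epsilon> where e: "\<delta> = var i + \<epsilon>"
      by (rule mon_eq_var_add)
    have "up_move \<delta> (var l + \<epsilon>)"
      using False \<open>i \<le> l\<close> e unfolding up_move_def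
      by (metis add.commute order_le_neq_trans)
    then have "var l + \<epsilon> \<in> monomials_in J"
      using J(2) l(2) unfolding strongly_stable_def by blast
    moreover have "\<beta> = var i + (var l + \<epsilon>)"
      using l(1) e by (simp add: ac_simps)
    ultimately show ?thesis
      using that i_def by simp
  qed
qed

section \<open>Termination\<close>

text \<open>The offset 2 keeps non-generators above generators even when their smallest variable is
  the least of all. \<open>Min\<close> is applied to a nonempty set there, since the constant
  monomial, if in \<open>J\<close>, is a generator.\<close>

definition reduction_rank ::
  "('v::{finite, linorder}, 'k::zero_neq_one) mpoly set \<Rightarrow> 'v mon \<Rightarrow> nat" where
  "reduction_rank J \<beta> =
    (if \<beta> \<notin> monomials_in J then 0
     else if \<beta> \<in> \<B> J then 1
     else card {..< Min (Poly_Mapping.keys \<beta>)} + 2)"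

lemma reduction_rank_var_add:
  assumes J: "monomial_ideal J" "strongly_stable J"
    and "\<gamma> \<in> \<N> J" "\<beta> \<in> monomials_in J" "\<beta> \<notin> \<B> J"
  shows "reduction_rank J (var (Min (Poly_Mapping.keys \<beta>)) + \<gamma>) < reduction_rank J \<beta>"
proof -
  define i where "i = Min (Poly_Mapping.keys \<beta>)"
  define j where "j = Min (Poly_Mapping.keys (var i + \<gamma>))"
  have "j < i" if in_J: "var i + \<gamma> \<in> monomials_in J" "var i + \<gamma> \<notin> \<B> J"
  proof -
    obtain \<delta> where d: "var i + \<gamma> = var j + \<delta>" "\<delta> \<in> monomials_in J"
      using strongly_stable_divide_Min[OF J in_J] unfolding j_def .
    \<comment> \<open>If \<open>j = i\<close>, cancelling the variable gives \<delta> = \<gamma>,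
      which would be both inside and outside \<open>J\<close>.\<close>
    have "j \<noteq> i"
      using d assms(3) by (auto simp: monomials_in_def monomials_out_def)
    moreover have "j \<le> i"
      unfolding j_def by (rule Min_le) (auto simp: in_keys_iff lookup_add)
    ultimately show ?thesis by simp
  qed
  then have "card {..<j} < card {..<i}" if "var i + \<gamma> \<in> monomials_in J" "var i + \<gamma> \<notin> \<B> J"
    using that by (intro psubset_card_mono) auto
  then show ?thesis
    using assms(4,5) unfolding reduction_rank_def i_def[symmetric] j_def[symmetric] by auto
qed

lemma lookup_pscale: "Poly_Mapping.lookup (pscale c p) \<alpha> = c * Poly_Mapping.lookup p \<alpha>"
  by (simp add: pscale_def Poly_Mapping.map.rep_eq when_def flip: mult_map_scale_conv_mult)

text \<open>The subtracted term cancels \<beta> exactly, and the assumption prevents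
  \<open>g\<close> from bringing it back.\<close>

lemma keys_replace:
  assumes "\<beta> \<notin> Poly_Mapping.keys g"
  shows "Poly_Mapping.keys (replace h \<beta> g) \<subseteq> Poly_Mapping.keys h - {\<beta>} \<union> Poly_Mapping.keys g"
proof
  fix \<alpha> assume "\<alpha> \<in> Poly_Mapping.keys (replace h \<beta> g)"
  then show "\<alpha> \<in> Poly_Mapping.keys h - {\<beta>} \<union> Poly_Mapping.keys g"
    using assms
    by (cases "\<alpha> = \<beta>")
      (auto simp: replace_def in_keys_iff lookup_add lookup_minus lookup_pscale lookup_single)
qed

text \<open>Nested induction: outside on a bound for the ranks occurring in \<open>h\<close>, inside
  on the number of monomials attaining it. A replacement removes one of these and adds only
  monomials of lower rank. The set \<open>D\<close> is an invariant, which allows a fixed degree to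
  be tracked.\<close>

lemma complete_gstar_reduction_if_decreasing:
  fixes rank :: "'v mon \<Rightarrow> nat"
  assumes decr: "\<And>\<beta>. \<beta> \<in> D \<Longrightarrow> \<beta> \<in> monomials_in J \<Longrightarrow>
      \<exists>g. Poly_Mapping.keys g \<subseteq> {\<gamma> \<in> D. rank \<gamma> < rank \<beta>} \<and>
        (\<forall>h. \<beta> \<in> Poly_Mapping.keys h \<longrightarrow> gstar_step J f h (replace h \<beta> g))"
    and zero: "\<And>\<beta>. rank \<beta> = 0 \<longleftrightarrow> \<beta> \<notin> monomials_in J"
    and "Poly_Mapping.keys h \<subseteq> D"
  shows "\<exists>h0. complete_gstar_reduction J f h h0 \<and> Poly_Mapping.keys h0 \<subseteq> D"
proof -
  have "\<exists>h0. complete_gstar_reduction J f h h0 \<and> Poly_Mapping.keys h0 \<subseteq> D"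
    if "Poly_Mapping.keys h \<subseteq> {\<beta> \<in> D. rank \<beta> \<le> r}" for h r
    using that
  proof (induction r arbitrary: h)
    case 0
    then have "normal_form J h"
      using zero by (auto simp: normal_form_def monomials_in_def monomials_out_def)
    then show ?case
      using 0 by (auto simp: complete_gstar_reduction_def)
  next
    case (Suc r)
    show ?case
      using Suc.prems
    proof (induction "card {\<beta> \<in> Poly_Mapping.keys h. rank \<beta> = Suc r}" arbitrary: h
        rule: less_induct)
      case less
      show ?case
      proof (cases "\<exists>\<beta> \<in> Poly_Mapping.keys h. rank \<beta> = Suc r")
        case False
        then show ?thesis
          using less.prems Suc.IH[of h] by (force simp: le_Suc_eq)
      next
        case True
        then obtain \<beta> where \<beta>: "\<beta> \<in> Poly_Mapping.keys h" "rank \<beta> = Suc r"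
          by blast
        then have "\<beta> \<in> D" "\<beta> \<in> monomials_in J"
          using less.prems zero[of \<beta>] by auto
        then obtain g where g: "Poly_Mapping.keys g \<subseteq> {\<gamma> \<in> D. rank \<gamma> < Suc r}"
          and step: "gstar_step J f h (replace h \<beta> g)"
          using decr[of \<beta>] \<beta> by auto
        have keys: "Poly_Mapping.keys (replace h \<beta> g)
            \<subseteq> Poly_Mapping.keys h - {\<beta>} \<union> Poly_Mapping.keys g"
          using g \<beta> by (intro keys_replace) auto
        have "\<beta> \<notin> Poly_Mapping.keys (replace h \<beta> g)"
          using keys g \<beta> by auto
        then have "card {\<gamma> \<in> Poly_Mapping.keys (replace h \<beta> g). rank \<gamma> = Suc r}
            < card {\<gamma> \<in> Poly_Mapping.keys h. rank \<gamma> = Suc r}"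
          using keys g \<beta> by (intro psubset_card_mono psubsetI) auto
        moreover have "Poly_Mapping.keys (replace h \<beta> g) \<subseteq> {\<gamma> \<in> D. rank \<gamma> \<le> Suc r}"
          using keys g less.prems by fastforce
        ultimately obtain h0 where "complete_gstar_reduction J f (replace h \<beta> g) h0"
          "Poly_Mapping.keys h0 \<subseteq> D"
          using less.hyps by blast
        then show ?thesis
          using step by (auto simp: complete_gstar_reduction_def intro: converse_rtranclp_into_rtranclp)
      qed
    qed
  qed
  \<comment> \<open>For \<open>h = 0\<close> the maximum is unspecified, but the inclusion is
    vacuous.\<close>
  moreover have "Poly_Mapping.keys h \<subseteq> {\<beta> \<in> D. rank \<beta> \<le> Max (rank ` Poly_Mapping.keys h)}"
    using assms(3) by auto
  ultimately show ?thesis by blast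
qed

section \<open>Existence of complete reductions for a \<open>J\<close>-set\<close>

context
  fixes J :: "('v::{finite, linorder}, 'k::comm_ring_1) mpoly set"
    and f :: "'v mon \<Rightarrow> ('v, 'k) mpoly"
  assumes J: "monomial_ideal J" "strongly_stable J" and f: "J_set J f"
begin

lemma reduction_rank_eq_0_iff: "reduction_rank J \<beta> = 0 \<longleftrightarrow> \<beta> \<notin> monomials_in J"
  by (simp add: reduction_rank_def)

text \<open>Provides the replacements required by
  \<open>complete_gstar_reduction_if_decreasing\<close>. The premise \<open>complete\<close>
  isolates the recursion on the degree: it asks for reductions only one degree below
  \<beta>.\<close>

lemma decreasing_replacement:
  assumes complete: "\<And>\<delta>. \<delta> \<in> monomials_in J \<Longrightarrow> Suc (mdeg \<delta>) = mdeg \<beta> \<Longrightarrow>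
      \<exists>g0. complete_gstar_reduction J f (X \<delta>) g0 \<and>
        Poly_Mapping.keys g0 \<subseteq> {\<gamma>. mdeg \<gamma> = mdeg \<delta>}"
    and \<beta>: "\<beta> \<in> monomials_in J"
  shows "\<exists>g. Poly_Mapping.keys g
        \<subseteq> {\<gamma> \<in> {\<gamma>. mdeg \<gamma> = mdeg \<beta>}. reduction_rank J \<gamma> < reduction_rank J \<beta>} \<and>
      (\<forall>h. \<beta> \<in> Poly_Mapping.keys h \<longrightarrow> gstar_step J f h (replace h \<beta> g))"
proof (cases "\<beta> \<in> \<B> J")
  case True
  \<comment> \<open>Monomials of the tail lie outside \<open>J\<close>, so they have rank 0, while a
    generator has rank 1.\<close>
  have "Poly_Mapping.keys (tail f \<beta>)
      \<subseteq> {\<gamma> \<in> {\<gamma>. mdeg \<gamma> = mdeg \<beta>}. reduction_rank J \<gamma> < reduction_rank J \<beta>}"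
    using True \<beta> f
    by (auto simp: J_set_def reduction_rank_def monomials_in_def monomials_out_def)
  then show ?thesis
    using True gstar_step.generator by blast
next
  case False
  define i where "i = Min (Poly_Mapping.keys \<beta>)"
  obtain \<delta> where \<delta>: "\<beta> = var i + \<delta>" "\<delta> \<in> monomials_in J"
    using strongly_stable_divide_Min[OF J \<beta> False] unfolding i_def .
  have deg: "Suc (mdeg \<delta>) = mdeg \<beta>"
    using \<delta>(1) by (simp add: mdeg_add)
  obtain g0 where g0: "(gstar_step J f)\<^sup>*\<^sup>* (X \<delta>) g0" "normal_form J g0"
    "Poly_Mapping.keys g0 \<subseteq> {\<gamma>. mdeg \<gamma> = mdeg \<delta>}"
    using complete[OF \<delta>(2) deg] unfolding complete_gstar_reduction_def by blast
  have "Poly_Mapping.keys (X (var i) * g0)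
      \<subseteq> {\<gamma> \<in> {\<gamma>. mdeg \<gamma> = mdeg \<beta>}. reduction_rank J \<gamma> < reduction_rank J \<beta>}"
  proof
    fix \<alpha> assume "\<alpha> \<in> Poly_Mapping.keys (X (var i) * g0)"
    from subsetD[OF keys_var_mult this] obtain \<gamma> where
      \<gamma>: "\<gamma> \<in> Poly_Mapping.keys g0" "\<alpha> = var i + \<gamma>"
      by (elim imageE)
    then have "reduction_rank J \<alpha> < reduction_rank J \<beta>"
      using reduction_rank_var_add[OF J _ \<beta> False] g0(2) by (auto simp: normal_form_def i_def)
    moreover have "mdeg \<alpha> = mdeg \<beta>"
      using \<gamma> g0(3) \<delta>(1) by (auto simp: mdeg_add)
    ultimately show "\<alpha> \<in> {\<gamma> \<in> {\<gamma>. mdeg \<gamma> = mdeg \<beta>}. reduction_rank J \<gamma> < reduction_rank J \<beta>}"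
      by simp
  qed
  then show ?thesis
    using gstar_step.multiple[OF _ \<beta> False \<delta> g0(1,2)] by blast
qed

text \<open>Strong induction on the degree, with the monomials of degree \<open>m\<close> as
  invariant set. Preservation of the degree serves both the recursion and the comparison of
  dimensions.\<close>

lemma complete_gstar_reduction_homogeneous:
  assumes "Poly_Mapping.keys h \<subseteq> {\<gamma>. mdeg \<gamma> = m}"
  shows "\<exists>h0. complete_gstar_reduction J f h h0 \<and> Poly_Mapping.keys h0 \<subseteq> {\<gamma>. mdeg \<gamma> = m}"
  using assms
proof (induction m arbitrary: h rule: less_induct)
  case (less m)
  show ?case
  proof (rule complete_gstar_reduction_if_decreasing[OF _ reduction_rank_eq_0_iff less.prems])
    fix \<beta> assume "\<beta> \<in> {\<gamma>. mdeg \<gamma> = m}" and in_J: "\<beta> \<in> monomials_in J"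
    then have deg: "mdeg \<beta> = m" by simp
    have "\<exists>g0. complete_gstar_reduction J f (X \<delta>) g0 \<and>
        Poly_Mapping.keys g0 \<subseteq> {\<gamma>. mdeg \<gamma> = mdeg \<delta>}" if "Suc (mdeg \<delta>) = mdeg \<beta>" for \<delta>
      using that deg by (intro less.IH) auto
    from decreasing_replacement[OF this in_J]
    show "\<exists>g. Poly_Mapping.keys g
          \<subseteq> {\<gamma> \<in> {\<gamma>. mdeg \<gamma> = m}. reduction_rank J \<gamma> < reduction_rank J \<beta>} \<and>
        (\<forall>h. \<beta> \<in> Poly_Mapping.keys h \<longrightarrow> gstar_step J f h (replace h \<beta> g))"
      unfolding deg by blast
  qed
qed

text \<open>The rank bounds do not depend on the degree, so monomials of different degrees are
  reduced together with \<open>UNIV\<close> as invariant set. The quotients \<open>X\<close>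
  \<delta> are covered by the homogeneous case.\<close>

lemma complete_gstar_reduction_exists: "\<exists>h0. complete_gstar_reduction J f h h0"
proof -
  have "\<exists>h0. complete_gstar_reduction J f h h0 \<and> Poly_Mapping.keys h0 \<subseteq> UNIV"
  proof (rule complete_gstar_reduction_if_decreasing[OF _ reduction_rank_eq_0_iff])
    fix \<beta> assume in_J: "\<beta> \<in> monomials_in J"
    have "\<exists>g0. complete_gstar_reduction J f (X \<delta>) g0 \<and>
        Poly_Mapping.keys g0 \<subseteq> {\<gamma>. mdeg \<gamma> = mdeg \<delta>}" for \<delta>
      by (rule complete_gstar_reduction_homogeneous) auto
    from decreasing_replacement[OF this in_J]
    show "\<exists>g. Poly_Mapping.keys g
          \<subseteq> {\<gamma> \<in> UNIV. reduction_rank J \<gamma> < reduction_rank J \<beta>} \<and>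
        (\<forall>h. \<beta> \<in> Poly_Mapping.keys h \<longrightarrow> gstar_step J f h (replace h \<beta> g))"
      by blast
  qed simp
  then show ?thesis by blast
qed

end

section \<open>Reduction modulo the ideal\<close>

lemma replace_congruent:
  assumes I: "ideal.subspace I" and "X \<beta> - g \<in> I"
  shows "h - replace h \<beta> g \<in> I"
proof -
  have "h - replace h \<beta> g = Poly_Mapping.single 0 (Poly_Mapping.lookup h \<beta>) * (X \<beta> - g)"
    by (simp add: replace_def pscale_def algebra_simps)
  then show ?thesis
    using ideal.subspace_scale[OF I assms(2)] by simp
qed

text \<open>The relation \<open>r\<close> is arbitrary because the induction hypothesis of
  \<open>gstar_step.multiple\<close> concerns the closure of steps conjoined with congruence, not of
  \<open>gstar_step\<close> alone.\<close>

lemma rtranclp_congruent: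
  assumes I: "ideal.subspace I" and "r\<^sup>*\<^sup>* h h'"
    and "\<And>p q. r p q \<Longrightarrow> p - q \<in> I"
  shows "h - h' \<in> I"
  using assms(2)
proof induction
  case base
  then show ?case using ideal.subspace_0[OF I] by simp
next
  case (step p q)
  then show ?case
    using ideal.subspace_add[OF I step.IH assms(3)[OF step.hyps(2)]] by simp
qed

lemma gstar_step_congruent:
  assumes I: "ideal.subspace I" "f ` \<B> J \<subseteq> I" and "gstar_step J f h h'"
  shows "h - h' \<in> I"
  using assms(3)
proof induction
  case (generator \<beta> h)
  \<comment> \<open>Here \<open>X\<close> \<beta> minus the tail is the element \<open>f\<close>
    \<beta> of \<open>I\<close>.\<close>
  then show ?case
    using I(2) by (intro replace_congruent[OF I(1)]) (auto simp: tail_def)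
next
  case (multiple \<beta> h i \<delta> g0)
  have "X \<delta> - g0 \<in> I"
    using rtranclp_congruent[OF I(1) multiple.IH] by blast
  then have "X (var i) * (X \<delta> - g0) \<in> I"
    by (rule ideal.subspace_scale[OF I(1)])
  then have "X \<beta> - X (var i) * g0 \<in> I"
    using multiple.hyps(4) by (simp add: algebra_simps mult_single)
  then show ?case
    by (rule replace_congruent[OF I(1)])
qed

lemma complete_gstar_reduction_congruent:
  assumes "ideal.subspace I" "f ` \<B> J \<subseteq> I" "complete_gstar_reduction J f h h0"
  shows "h - h0 \<in> I"
  using rtranclp_congruent[OF assms(1), of "gstar_step J f" h h0] assms(3)
    gstar_step_congruent[OF assms(1,2)]
  by (auto simp: complete_gstar_reduction_def)

section \<open>Cosets and the span of the monomials outside \<open>J\<close>\<close>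

lemma coset_eq:
  fixes I :: "('v, 'k::comm_ring_1) mpoly set"
  assumes I: "ideal.subspace I" and "p - q \<in> I"
  shows "p +o I = q +o I"
proof -
  have "a +o I \<subseteq> b +o I" if "a - b \<in> I" for a b
  proof
    fix x assume "x \<in> a +o I"
    then obtain y where "y \<in> I" "x = a + y"
      by (auto simp: elt_set_plus_def)
    then have "x = b + ((a - b) + y)" "(a - b) + y \<in> I"
      using ideal.subspace_add[OF I that] by auto
    then show "x \<in> b +o I"
      unfolding elt_set_plus_def by blast
  qed
  moreover have "q - p \<in> I"
    using ideal.subspace_neg[OF I assms(2)] by simp
  ultimately show ?thesis
    using assms(2) by blast
qed

lemma sum_single_keys:
  "p = (\<Sum>\<alpha>\<in>Poly_Mapping.keys p. pscale (Poly_Mapping.lookup p \<alpha>) (X \<alpha>))"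
proof (rule poly_mapping_eqI)
  fix \<beta>
  show "Poly_Mapping.lookup p \<beta> = Poly_Mapping.lookup
      (\<Sum>\<alpha>\<in>Poly_Mapping.keys p. pscale (Poly_Mapping.lookup p \<alpha>) (X \<alpha>)) \<beta>"
    by (simp add: lookup_sum lookup_pscale lookup_single when_def if_distrib[of "(*) _"]
        in_keys_iff cong: if_cong)
qed

lemma coset_in_quotient_span:
  fixes I :: "('v, 'k::comm_ring_1) mpoly set"
  assumes I: "ideal.subspace I" and "Poly_Mapping.keys p \<subseteq> S"
  shows "p +o I \<in> quotient_span I ((\<lambda>\<gamma>. X \<gamma> +o I) ` S)"
proof -
  \<comment> \<open>The coefficients are detached from \<open>p\<close>, so that the induction can
    run over the index set alone.\<close>
  have "(\<Sum>\<alpha>\<in>A. pscale (c \<alpha>) (X \<alpha>)) +o I \<in> quotient_span I ((\<lambda>\<gamma>. X \<gamma> +o I) ` S)"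
    if "finite A" "A \<subseteq> S" for A and c :: "'v mon \<Rightarrow> 'k"
    using that
  proof (induction A rule: finite_induct)
    case empty
    then show ?case by (simp add: coset_zero quotient_span.zero)
  next
    case (insert \<alpha> A)
    have "pscale (c \<alpha>) (X \<alpha>) +o I \<in> quotient_span I ((\<lambda>\<gamma>. X \<gamma> +o I) ` S)"
      unfolding coset_scale_coset[OF I, symmetric]
      using insert.prems by (intro quotient_span.scale quotient_span.base) auto
    with insert show ?case
      by (auto simp: coset_add[OF I, symmetric] intro: quotient_span.add)
  qed
  from this[of "Poly_Mapping.keys p" "Poly_Mapping.lookup p"] assms(2) show ?thesis
    by (simp flip: sum_single_keys)
qed

lemma quotient_span_subset_quotient_space:
  assumes I: "ideal.subspace I" and "S \<subseteq> quotient_space I"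
  shows "quotient_span I S \<subseteq> quotient_space I"
proof
  fix A assume "A \<in> quotient_span I S"
  then show "A \<in> quotient_space I"
  proof induction
    case zero
    then show ?case unfolding quotient_space_def by (metis coset_zero rangeI)
  next
    case (base A)
    then show ?case using assms(2) by blast
  next
    case (add A B)
    then show ?case by (auto simp: quotient_space_def coset_add[OF I])
  next
    case (scale A c)
    then show ?case by (auto simp: quotient_space_def coset_scale_coset[OF I])
  qed
qed

lemma quotient_span_eq_quotient_space:
  fixes I :: "('v, 'k::comm_ring_1) mpoly set"
  assumes I: "ideal.subspace I"
    and nf: "\<And>h. \<exists>h0. Poly_Mapping.keys h0 \<subseteq> S \<and> h - h0 \<in> I"
  shows "quotient_span I ((\<lambda>\<gamma>. X \<gamma> +o I) ` S) = quotient_space I"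
proof
  show "quotient_span I ((\<lambda>\<gamma>. X \<gamma> +o I) ` S) \<subseteq> quotient_space I"
    by (rule quotient_span_subset_quotient_space[OF I]) (auto simp: quotient_space_def)
  show "quotient_space I \<subseteq> quotient_span I ((\<lambda>\<gamma>. X \<gamma> +o I) ` S)"
  proof
    fix A assume "A \<in> quotient_space I"
    then obtain h where h: "A = h +o I"
      by (auto simp: quotient_space_def)
    obtain h0 where "Poly_Mapping.keys h0 \<subseteq> S" "h - h0 \<in> I"
      using nf by blast
    then show "A \<in> quotient_span I ((\<lambda>\<gamma>. X \<gamma> +o I) ` S)"
      using coset_in_quotient_span[OF I] coset_eq[OF I] h by metis
  qed
qed

section \<open>Dimensions\<close>

text \<open>The coordinate projection onto the span of the monomials in \<open>S\<close>.\<close>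

definition restrict_monomials :: "'v mon set \<Rightarrow> ('v, 'k::comm_ring_1) mpoly \<Rightarrow> ('v, 'k) mpoly" where
  "restrict_monomials S p =
    (\<Sum>\<alpha>\<in>Poly_Mapping.keys p \<inter> S. Poly_Mapping.single \<alpha> (Poly_Mapping.lookup p \<alpha>))"

lemma lookup_restrict_monomials:
  "Poly_Mapping.lookup (restrict_monomials S p) \<alpha> = (if \<alpha> \<in> S then Poly_Mapping.lookup p \<alpha> else 0)"
  by (auto simp: restrict_monomials_def lookup_sum lookup_single when_def in_keys_iff)

lemma restrict_monomials_hom:
  "module_hom pscale pscale
     (restrict_monomials S :: ('v, 'k::field) mpoly \<Rightarrow> ('v, 'k) mpoly)"
  by (intro module_hom.intro module_hom_axioms.intro poly_vs.module_axioms poly_mapping_eqI)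
    (auto simp: lookup_restrict_monomials lookup_add lookup_pscale)

lemma restrict_monomials_diff_eq:
  assumes "Poly_Mapping.keys q \<subseteq> S" "Poly_Mapping.keys p \<inter> S = {}"
  shows "restrict_monomials S (q - p) = q"
  using assms
  by (intro poly_mapping_eqI) (auto simp: lookup_restrict_monomials lookup_minus in_keys_iff)

text \<open>The projection is linear, so the image of a basis of the part of \<open>V\<close> spans
  a space containing the part of \<open>W\<close>.\<close>

lemma dim_degree_part_le:
  fixes V W :: "('v::finite, 'k::field) mpoly set"
  assumes "\<And>q. q \<in> degree_part W m \<Longrightarrow> \<exists>p \<in> degree_part V m. restrict_monomials S p = q"
  shows "poly_vs.dim (degree_part W m) \<le> poly_vs.dim (degree_part V m)"
proof -
  obtain B where B: "B \<subseteq> degree_part V m" "poly_vs.independent B"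
    "degree_part V m \<subseteq> poly_vs.span B" "card B = poly_vs.dim (degree_part V m)"
    by (rule poly_vs.basis_exists)
  let ?M = "X ` {\<alpha> :: 'v mon. mdeg \<alpha> = m} :: ('v, 'k) mpoly set"
  have "p \<in> poly_vs.span ?M" if "p \<in> degree_part V m" for p
  proof -
    have "pscale (Poly_Mapping.lookup p \<alpha>) (X \<alpha>) \<in> poly_vs.span ?M"
      if "\<alpha> \<in> Poly_Mapping.keys p" for \<alpha>
      using that \<open>p \<in> degree_part V m\<close>
      by (intro poly_vs.span_scale poly_vs.span_base) (auto simp: degree_part_def)
    then show ?thesis
      by (subst sum_single_keys) (rule poly_vs.span_sum)
  qed
  then have "B \<subseteq> poly_vs.span ?M"
    using B(1) by blast
  \<comment> \<open>An infinite set has \<open>card\<close> equal to 0, so finiteness is what makes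
    the two estimates below meaningful.\<close>
  then have "finite B"
    using poly_vs.independent_span_bound[OF _ B(2), of ?M] finite_mdeg_eq by blast
  have "degree_part W m \<subseteq> restrict_monomials S ` poly_vs.span B"
    using assms B(3) by blast
  also have "\<dots> = poly_vs.span (restrict_monomials S ` B)"
    using module_hom.span_image[OF restrict_monomials_hom] by metis
  finally have "poly_vs.dim (degree_part W m) \<le> card (restrict_monomials S ` B)"
    using \<open>finite B\<close> by (intro poly_vs.dim_le_card) auto
  also have "\<dots> \<le> card B"
    by (rule card_image_le[OF \<open>finite B\<close>])
  finally show ?thesis
    using B(4) by simp
qed

theorem corollary11:
  fixes J I :: "('v::{finite, linorder}, 'k::alg_closed_field) mpoly set"
    and f :: "'v mon \<Rightarrow> ('v, 'k) mpoly"
  assumes "monomial_ideal J" and "strongly_stable J"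
    and "homogeneous_ideal I"
    and "J_set J f" and "f ` \<B> J \<subseteq> I"
  shows "(\<forall>h. \<exists>h0. normal_form J h0 \<and> h - h0 \<in> I \<and> complete_gstar_reduction J f h h0) \<and>
    quotient_span I ((\<lambda>\<gamma>. X \<gamma> +o I) ` \<N> J) = quotient_space I \<and>
    (\<forall>m. poly_vs.dim (degree_part J m) \<le> poly_vs.dim (degree_part I m))"
proof (intro conjI allI)
  have I: "ideal.subspace I"
    using assms(3) by (simp add: homogeneous_ideal_def)
  note congruent = complete_gstar_reduction_congruent[OF I assms(5)]
  show nf: "\<exists>h0. normal_form J h0 \<and> h - h0 \<in> I \<and> complete_gstar_reduction J f h h0" for h
    using complete_gstar_reduction_exists[OF assms(1,2,4), of h] congruent[of h]
    unfolding complete_gstar_reduction_def by blast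
  show "quotient_span I ((\<lambda>\<gamma>. X \<gamma> +o I) ` \<N> J) = quotient_space I"
    using nf by (intro quotient_span_eq_quotient_space[OF I]) (auto simp: normal_form_def)
  show "poly_vs.dim (degree_part J m) \<le> poly_vs.dim (degree_part I m)" for m
  proof (rule dim_degree_part_le[where S = "monomials_in J"])
    fix q assume "q \<in> degree_part J m"
    then have q: "q \<in> J" "Poly_Mapping.keys q \<subseteq> {\<gamma>. mdeg \<gamma> = m}"
      by (auto simp: degree_part_def)
    \<comment> \<open>The homogeneous version is taken here so that \<open>q - h0\<close> stays in
      degree \<open>m\<close>.\<close>
    obtain h0 where h0: "complete_gstar_reduction J f q h0"
      "Poly_Mapping.keys h0 \<subseteq> {\<gamma>. mdeg \<gamma> = m}"
      using complete_gstar_reduction_homogeneous[OF assms(1,2,4) q(2)] by blast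
    then have "Poly_Mapping.keys (q - h0) \<subseteq> {\<gamma>. mdeg \<gamma> = m}"
      using q(2) keys_diff[of q h0] by blast
    then have "q - h0 \<in> degree_part I m"
      using congruent[OF h0(1)] by (auto simp: degree_part_def)
    \<comment> \<open>All monomials of \<open>q\<close> lie in \<open>J\<close> and all those of
      \<open>h0\<close> outside, so the projection keeps \<open>q\<close> and removes
      \<open>h0\<close>.\<close>
    moreover have "restrict_monomials (monomials_in J) (q - h0) = q"
      using h0(1) keys_monomial_ideal[OF assms(1) q(1)]
      by (intro restrict_monomials_diff_eq)
        (auto simp: complete_gstar_reduction_def normal_form_def monomials_in_def monomials_out_def)
    ultimately show "\<exists>p \<in> degree_part I m. restrict_monomials (monomials_in J) p = q"
      by blast
  qed
qed

end
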